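(* Let the density $p$ have bounded variation on $\mathbb{R}$, $\mathbf{V}(p)=V<\infty$, and let $p_n=p_{n,h_n}$ be the sinc estimator with $h_n=h_0/\sqrt n$ for some constant $h_0>0$. Then $$\mathrm{MISE}(p_n)\le\frac{1}{\pi\sqrt n}\Bigl(V^2h_0+\frac1{h_0}\Bigr).$$
   Context: Let $X_1,\dots,X_n$ be i.i.d. real random variables with probability density $p$ (not assumed differentiable or continuous). The sinc kernel is $K(x)=\frac{\sin x}{\pi x}$ (with $K(0)=1/\pi$); the sinc estimator with bandwidth $h>0$ is $p_{n,h}(x)=\frac1{nh}\sum_{j=1}^nK\bigl((x-X_j)/h\bigr)$, equivalently $p_{n,h}(x)=\frac1{2\pi}\int_{-1/h}^{1/h}e^{-itx}f_n(t)\,dt$ with $f_n(t)=\frac1n\sum_{j=1}^ne^{itX_j}$. Define $\mathrm{MISE}(p_{n,h})=\mathrm{E}\int\{p_{n,h}(x)-p(x)\}^2\,dx$. $\mathbf{V}(g)$ is the total variation of $g$ over the whole real line. *)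

theory Defs
  imports "HOL-Probability.Probability"
begin

(* sinc is the library's sinc, i.e. sin x / x extended by 1 at 0. *)
definition sinc_kernel :: "real \<Rightarrow> real" where
  "sinc_kernel x = sinc x / pi"

(* The sample is X 1, ..., X n (no X 0). *)
definition sinc_estimator ::
    "(nat \<Rightarrow> 'a \<Rightarrow> real) \<Rightarrow> nat \<Rightarrow> real \<Rightarrow> 'a \<Rightarrow> real \<Rightarrow> real" where
  "sinc_estimator X n h \<omega> x =
     1 / (real n * h) * (\<Sum>j=1..n. sinc_kernel ((x - X j \<omega>) / h))"

(* Both the expectation and the inner integral are extended nonnegative integrals,
   so a bound on MISE entails its finiteness. *)
definition MISE :: "'a measure \<Rightarrow> ('a \<Rightarrow> real \<Rightarrow> real) \<Rightarrow> (real \<Rightarrow> real) \<Rightarrow> ennreal" where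
  "MISE M q p = (\<integral>\<^sup>+ \<omega>. (\<integral>\<^sup>+ x. ennreal ((q \<omega> x - p x)\<^sup>2) \<partial>lborel) \<partial>M)"

(* Supremum over all finite nondecreasing point sequences t 0 <= ... <= t m in the
   real line; repeated points contribute 0. *)
definition total_variation :: "(real \<Rightarrow> real) \<Rightarrow> ennreal" where
  "total_variation g =
     (SUP m. SUP t\<in>{t :: nat \<Rightarrow> real. mono_on {..m} t}.
        \<Sum>i<m. ennreal \<bar>g (t (Suc i)) - g (t i)\<bar>)"

end

theory Submission
  imports Defs
begin

text \<open>
  By Tonelli the MISE is the integrated variance plus the integrated squared bias. Independence bounds
  the variance term by $\frac{1}{nh} \int K^2 = \frac{1}{\pi n h}$.

  For the bias no Plancherel theorem is needed. Let $G$ be the primitive of $K$ minus the Heaviside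
  function, so that $K_h * p - p = G(\cdot/h) * dp$. Young's inequality then gives
  $\|K_h * p - p\|_2 \le V \sqrt{h}\, \|G\|_2$, and $\int G^2 = 1/\pi$ has an explicit
  antiderivative in terms of the sine integral. The Stieltjes measure $dp$ is replaced by the
  difference quotients $(p(y+\varepsilon) - p(y))/\varepsilon$, whose $L^1$ norms are at most $V$;
  Fatou's lemma gives the bound in the limit $\varepsilon \to 0$.
\<close>

section \<open>The sine integral\<close>

lemma sinc_kernel_mult: "x * sinc_kernel x = sin x / pi"
  by (simp add: sinc_kernel_def)

lemma abs_sinc_kernel_le: "\<bar>sinc_kernel x\<bar> \<le> 1 / pi"
proof -
  have "\<bar>sinc x\<bar> \<le> 1"
    using abs_sin_x_le_abs_x[of x] by (simp add: divide_le_eq)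
  then show ?thesis
    unfolding sinc_kernel_def abs_divide by (simp add: divide_right_mono)
qed

lemma isCont_sinc_kernel: "isCont sinc_kernel x"
  unfolding sinc_kernel_def using isCont_sinc[of x] by (intro isCont_divide) auto

lemma borel_measurable_sinc_kernel [measurable]: "sinc_kernel \<in> borel_measurable borel"
  unfolding sinc_kernel_def by measurable

lemma DERIV_Si_sinc_kernel: "(Si has_real_derivative pi * sinc_kernel x) (at x)"
  unfolding sinc_kernel_def using DERIV_Si[of x] by simp

lemma Si_minus: "Si (- x) = - Si x"
  using Si_neg[of x] Si_neg[of "- x"] by (cases "x \<ge> 0") auto

lemma Si_0: "Si 0 = 0"
  using Si_minus[of 0] by simp

lemma Si_double_at_top: "((\<lambda>x. Si (2 * x)) \<longlongrightarrow> pi / 2) at_top"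
  by (rule filterlim_compose[OF Si_at_top])
     (auto intro!: filterlim_tendsto_pos_mult_at_top[where c = 2] filterlim_ident)

lemma DERIV_Si_double:
  "((\<lambda>x. Si (2 * x)) has_real_derivative 2 * pi * sinc_kernel (2 * x)) (at x)"
proof -
  have "((\<lambda>x. 2 * x) has_real_derivative 2) (at x)"
    by (auto intro!: derivative_eq_intros)
  from DERIV_chain2[OF DERIV_Si_sinc_kernel this] show ?thesis
    by (simp add: mult_ac)
qed

section \<open>The square integral of the sinc kernel\<close>

lemma nn_integral_even:
  fixes f :: "real \<Rightarrow> ennreal"
  assumes [measurable]: "f \<in> borel_measurable borel" and even: "\<And>x. f (- x) = f x"
  shows "(\<integral>\<^sup>+x. f x \<partial>lborel) = 2 * (\<integral>\<^sup>+x. f x * indicator {0..} x \<partial>lborel)"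
proof -
  have "(\<integral>\<^sup>+x. f x * indicator {..0} x \<partial>lborel) = (\<integral>\<^sup>+x. f x * indicator {0..} x \<partial>lborel)"
    by (subst nn_integral_real_affine[where c = "-1" and t = 0])
       (auto simp: even indicator_def intro!: nn_integral_cong)
  moreover have "(\<integral>\<^sup>+x. f x \<partial>lborel) =
      (\<integral>\<^sup>+x. f x * indicator {..0} x + f x * indicator {0..} x \<partial>lborel)"
    using AE_lborel_singleton[of 0]
    by (intro nn_integral_cong_AE) (auto simp: indicator_def)
  ultimately show ?thesis
    by (simp add: nn_integral_add mult_2)
qed

text \<open>Integration by parts turns sin^2 x / x^2 into sin (2x) / x, whose primitive is
  \<open>Si (2 * x)\<close>. This yields the explicit antiderivative \<open>F\<close> of the squared
  kernel; it rises from 0 at the origin to 1 / (2 pi) at infinity, and evenness doubles that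
  value.\<close>

lemma nn_integral_sinc_kernel_square:
  "(\<integral>\<^sup>+x. ennreal ((sinc_kernel x)\<^sup>2) \<partial>lborel) = ennreal (1 / pi)"
proof -
  define F where "F x = (Si (2 * x) / pi - sin x * sinc_kernel x) / pi" for x
  have sin_K: "((\<lambda>x. sin x * sinc_kernel x) has_real_derivative
      2 * sinc_kernel (2 * x) - pi * (sinc_kernel x)\<^sup>2) (at x)" for x
  proof (cases "x = 0")
    case False
    have sin2: "sin (x * 2) = cos x * (sin x * 2)"
      using sin_double[of x] by (simp add: mult_ac)
    have "((\<lambda>x. sin x * (sin x / x / pi)) has_real_derivative
        2 * sinc_kernel (2 * x) - pi * (sinc_kernel x)\<^sup>2) (at x)"
      using False
      by (auto intro!: derivative_eq_intros
        simp: sinc_kernel_def sin2 power2_eq_square field_simps)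
    then show ?thesis
      by (rule has_field_derivative_transform_within_open[where S = "- {0}"])
         (use False in \<open>auto simp: sinc_kernel_def\<close>)
  next
    case True
    have "(\<lambda>h. (sinc_kernel h)\<^sup>2 * pi) \<midarrow>0\<rightarrow> (sinc_kernel 0)\<^sup>2 * pi"
      by (intro tendsto_intros isCont_sinc_kernel[unfolded isCont_def])
    then have "((\<lambda>x. sin x * sinc_kernel x) has_real_derivative (sinc_kernel 0)\<^sup>2 * pi) (at 0)"
      unfolding DERIV_def
      by (rule Lim_transform_eventually)
         (auto simp: sinc_kernel_def power2_eq_square eventually_at_filter)
    then show ?thesis
      using True by (simp add: sinc_kernel_def power2_eq_square)
  qed
  have "(F has_real_derivative (sinc_kernel x)\<^sup>2) (at x)" for x
    unfolding F_def
    by (rule DERIV_cong[OF DERIV_cdivide[OF DERIV_diff[OF DERIV_cdivide[OF DERIV_Si_double] sin_K]]])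
       simp
  moreover have "(F \<longlongrightarrow> (pi / 2 / pi - 0) / pi) at_top"
    unfolding F_def
  proof (intro tendsto_intros Si_double_at_top)
    have "((\<lambda>x. sin x ^ 2 / (x * pi)) \<longlongrightarrow> 0) at_top"
    proof (rule tendsto_sandwich[where f = "\<lambda>_. 0" and h = "\<lambda>x. 1 / (x * pi)"])
      show "\<forall>\<^sub>F x in at_top. (sin x)\<^sup>2 / (x * pi) \<le> 1 / (x * pi)"
        using eventually_gt_at_top[of 0]
        by eventually_elim (auto simp: divide_right_mono abs_square_le_1)
      show "\<forall>\<^sub>F x in at_top. 0 \<le> (sin x)\<^sup>2 / (x * pi)"
        using eventually_gt_at_top[of 0] by eventually_elim auto
    qed real_asymp+
    then show "((\<lambda>x. sin x * sinc_kernel x) \<longlongrightarrow> 0) at_top"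
      by (rule Lim_transform_eventually)
         (use eventually_gt_at_top[of 0] in eventually_elim,
           auto simp: sinc_kernel_def power2_eq_square)
  qed auto
  ultimately have "(\<integral>\<^sup>+x. ennreal ((sinc_kernel x)\<^sup>2) * indicator {0..} x \<partial>lborel)
      = (pi / 2 / pi - 0) / pi - F 0"
    by (intro nn_integral_FTC_atLeast) auto
  then have "(\<integral>\<^sup>+x. ennreal ((sinc_kernel x)\<^sup>2) * indicator {0..} x \<partial>lborel)
      = ennreal (1 / (2 * pi))"
    by (simp add: F_def Si_0)
  then show ?thesis
    by (subst nn_integral_even) (auto simp: sinc_kernel_def ennreal_mult'[symmetric] simp del: ennreal_mult' simp flip: ennreal_numeral)
qed

section \<open>Tail of the sine integral and square integral of the step error\<close>

text \<open>One integration by parts writes the tail of sin t / t beyond x as cos x / x minus the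
  integral of cos t / t^2 over t > x. Both terms are at most 1 / x in absolute value. The function
  \<open>A c x\<close> encodes the integral of (c - cos t) / t^2 over the tail, which has a definite
  sign for c = 1 and c = -1, so no improper integral has to be formed.\<close>

lemma Si_residual_bound:
  assumes "0 < x"
  shows "\<bar>pi / 2 - Si x\<bar> \<le> 2 / x"
proof -
  define A where "A c x = pi / 2 - Si x - cos x / x + c / x" for c x :: real
  have deriv: "(A c has_real_derivative (cos x - c) / x\<^sup>2) (at x)" if "0 < x" for c x
  proof -
    have "((\<lambda>x. pi / 2 - Si x - cos x / x + c / x) has_real_derivative
       0 - pi * sinc_kernel x - (- sin x * x - cos x * 1) / (x * x) + (0 * x - c * 1) / (x * x)) (at x)"
      using that
      by (intro DERIV_diff DERIV_add DERIV_divide DERIV_const DERIV_cos DERIV_ident DERIV_Si_sinc_kernel) auto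
    then show ?thesis
      unfolding A_def
      by (rule DERIV_cong) (use that in \<open>simp add: sinc_kernel_def power2_eq_square field_simps\<close>)
  qed
  have lim: "(A c \<longlongrightarrow> pi / 2 - pi / 2 - 0 + 0) at_top" for c
    unfolding A_def
  proof (intro tendsto_intros Si_at_top)
    show "((\<lambda>x::real. cos x / x) \<longlongrightarrow> 0) at_top"
    proof (rule tendsto_sandwich[where f = "\<lambda>x. - 1 / x" and h = "\<lambda>x. 1 / x"])
      show "\<forall>\<^sub>F x in at_top. - 1 / x \<le> cos x / (x::real)"
        using eventually_gt_at_top[of 0]
        by eventually_elim (intro divide_right_mono, auto)
      show "\<forall>\<^sub>F x in at_top. cos x / x \<le> 1 / (x::real)"
        using eventually_gt_at_top[of 0]
        by eventually_elim (intro divide_right_mono, auto)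
    qed real_asymp+
    show "((\<lambda>x. c / x) \<longlongrightarrow> 0) at_top"
      by real_asymp
  qed
  \<comment> \<open>\<open>A 1\<close> decreases to its limit 0 at infinity and is therefore
    nonnegative; symmetrically \<open>A (- 1)\<close> increases to 0 and is nonpositive.\<close>
  have "0 \<le> A 1 x"
  proof -
    have "A 1 y \<le> A 1 x" if "x \<le> y" for y
    proof (rule DERIV_nonpos_imp_nonincreasing[OF that])
      fix z assume "x \<le> z" "z \<le> y"
      then show "\<exists>d. DERIV (A 1) z :> d \<and> d \<le> 0"
        using deriv[of z 1] assms by (intro exI[of _ "(cos z - 1) / z\<^sup>2"]) (auto simp: divide_le_0_iff)
    qed
    then have "pi / 2 - pi / 2 - 0 + 0 \<le> A 1 x"
      by (intro tendsto_upperbound[OF lim]) (auto intro: eventually_at_top_linorderI[of x])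
    then show ?thesis by simp
  qed
  moreover have "A (- 1) x \<le> 0"
  proof -
    have "A (- 1) x \<le> A (- 1) y" if "x \<le> y" for y
    proof (rule DERIV_nonneg_imp_nondecreasing[OF that])
      fix z assume "x \<le> z" "z \<le> y"
      then show "\<exists>d. DERIV (A (- 1)) z :> d \<and> d \<ge> 0"
        using deriv[of z "- 1"] assms
        by (intro exI[of _ "(cos z - - 1) / z\<^sup>2"] conjI divide_nonneg_nonneg)
          (auto intro!: cos_ge_minus_one[THEN diff_ge_0_iff_ge[THEN iffD2]] simp del: diff_minus_eq_add)
    qed
    then have "A (- 1) x \<le> pi / 2 - pi / 2 - 0 + 0"
      by (intro tendsto_lowerbound[OF lim]) (auto intro: eventually_at_top_linorderI[of x])
    then show ?thesis by simp
  qed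
  moreover have "cos x / x \<le> 1 / x" "- 1 / x \<le> cos x / x"
    using assms cos_le_one[of x] cos_ge_minus_one[of x] by (intro divide_right_mono; simp)+
  moreover have "2 / x = 1 / x + 1 / x" by simp
  ultimately show ?thesis
    unfolding A_def by (auto simp: abs_le_iff)
qed

text \<open>The primitive of the sinc kernel minus the Heaviside function; it vanishes at both infinities.\<close>

definition sinc_step_error :: "real \<Rightarrow> real" where
  "sinc_step_error x = (if x < 0 then Si x + pi / 2 else Si x - pi / 2) / pi"

lemma borel_measurable_sinc_step_error [measurable]: "sinc_step_error \<in> borel_measurable borel"
  unfolding sinc_step_error_def by measurable

lemma sinc_step_error_bounded: "\<exists>B. \<forall>x. \<bar>sinc_step_error x\<bar> \<le> B"
proof -
  obtain B where B: "\<And>x. \<bar>Si x\<bar> \<le> B"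
    using bounded_Si by blast
  have "\<bar>sinc_step_error x\<bar> \<le> (B + pi / 2) / pi" for x
  proof -
    have "\<bar>Si x + pi / 2\<bar> \<le> B + pi / 2" "\<bar>Si x - pi / 2\<bar> \<le> B + pi / 2"
      using B[of x] pi_gt_zero by linarith+
    then show ?thesis
      unfolding sinc_step_error_def abs_divide abs_of_pos[OF pi_gt_zero]
      by (intro divide_right_mono) auto
  qed
  then show ?thesis by blast
qed

text \<open>The indicator is the increment of the Heaviside function. As the step error takes its
  right-hand value at 0, the jump is crossed exactly when u < 0 <= u + d, hence the half-open
  interval.\<close>

lemma sinc_step_error_diff:
  assumes "0 < d"
  shows "sinc_step_error (u + d) - sinc_step_error u =
    (Si (u + d) - Si u) / pi - indicator {-d..<0} u"
  using assms by (auto simp: sinc_step_error_def indicator_def field_simps)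

text \<open>Two integrations by parts give the antiderivative of g^2. Since x g'(x) = sin x, the
  first leaves -2 g sin x; the second leaves -2 g' cos x = -sin (2x) / x, with primitive
  \<open>- Si (2 * x)\<close>. On the half-line \<open>F\<close> runs from -1 / pi to -1 / (2 pi),
  and evenness doubles the difference.\<close>

lemma nn_integral_sinc_step_error_square:
  "(\<integral>\<^sup>+x. ennreal ((sinc_step_error x)\<^sup>2) \<partial>lborel) = ennreal (1 / pi)"
proof -
  define g where "g x = Si x - pi / 2" for x
  define F where "F x = (x * (g x)\<^sup>2 + 2 * (g x * cos x) - Si (2 * x)) / pi\<^sup>2" for x
  have g: "(g has_real_derivative pi * sinc_kernel x) (at x)" for x
    unfolding g_def by (rule DERIV_cong[OF DERIV_diff[OF DERIV_Si_sinc_kernel DERIV_const]]) simp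
  have sin_cos: "sinc_kernel (2 * x) = sinc_kernel x * cos x" for x
    by (simp add: sinc_kernel_def sin_double)
  have F: "(F has_real_derivative (g x / pi)\<^sup>2) (at x)" for x
  proof -
    have "((\<lambda>x. (x * (g x)\<^sup>2 + 2 * (g x * cos x) - Si (2 * x)) / pi\<^sup>2) has_real_derivative
        ((1 * (g x)\<^sup>2 + (2 * (pi * sinc_kernel x * g x ^ (2 - 1))) * x
        + 2 * (pi * sinc_kernel x * cos x + - sin x * g x) - 2 * pi * sinc_kernel (2 * x)) / pi\<^sup>2)) (at x)"
      by (intro DERIV_cdivide DERIV_diff DERIV_add DERIV_mult DERIV_cmult g DERIV_cos DERIV_ident
          DERIV_Si_double) (use DERIV_power[OF g, where n = 2] in simp)
    moreover have "sin x = pi * (x * sinc_kernel x)"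
      using sinc_kernel_mult[of x] by (simp add: field_simps)
    ultimately show ?thesis
      unfolding F_def sin_cos by (elim DERIV_cong) (simp add: power_divide algebra_simps)
  qed
  have g_lim: "(g \<longlongrightarrow> 0) at_top"
    unfolding g_def by (rule LIM_zero[OF Si_at_top])
  have "(F \<longlongrightarrow> (0 + 2 * 0 - pi / 2) / pi\<^sup>2) at_top"
    unfolding F_def
  proof (intro tendsto_intros Si_double_at_top)
    \<comment> \<open>Convergence of g to 0 alone does not control this boundary term; the tail
      bound 2 / x does.\<close>
    show "((\<lambda>x. x * (g x)\<^sup>2) \<longlongrightarrow> 0) at_top"
    proof (rule tendsto_sandwich[where f = "\<lambda>_. 0" and h = "\<lambda>x. 4 / x"])
      show "\<forall>\<^sub>F x in at_top. x * (g x)\<^sup>2 \<le> 4 / x"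
        using eventually_gt_at_top[of 0]
      proof eventually_elim
        case (elim x)
        have "\<bar>g x\<bar>\<^sup>2 \<le> (2 / x)\<^sup>2"
          using Si_residual_bound[OF elim] by (intro power_mono) (auto simp: g_def abs_minus_commute)
        then have "x * (g x)\<^sup>2 \<le> x * (2 / x)\<^sup>2"
          using elim by (intro mult_left_mono) auto
        then show ?case
          using elim by (simp add: power2_eq_square)
      qed
      show "\<forall>\<^sub>F x in at_top. 0 \<le> x * (g x)\<^sup>2"
        using eventually_gt_at_top[of 0] by eventually_elim auto
    qed real_asymp+
    show "((\<lambda>x. g x * cos x) \<longlongrightarrow> 0) at_top"
      by (rule Lim_null_comparison[OF _ g_lim[THEN tendsto_rabs_zero]])
         (auto simp: abs_mult mult_left_le)
  qed auto
  then have "(\<integral>\<^sup>+x. ennreal ((g x / pi)\<^sup>2) * indicator {0..} x \<partial>lborel)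
      = (0 + 2 * 0 - pi / 2) / pi\<^sup>2 - F 0"
    using F by (intro nn_integral_FTC_atLeast) (auto simp: g_def)
  also have "\<dots> = ennreal (1 / (2 * pi))"
    by (simp add: F_def g_def Si_0 power2_eq_square field_simps)
  also have "(\<integral>\<^sup>+x. ennreal ((g x / pi)\<^sup>2) * indicator {0..} x \<partial>lborel) =
      (\<integral>\<^sup>+x. ennreal ((sinc_step_error x)\<^sup>2) * indicator {0..} x \<partial>lborel)"
    by (intro nn_integral_cong) (auto simp: g_def sinc_step_error_def indicator_def)
  finally have half: "(\<integral>\<^sup>+x. ennreal ((sinc_step_error x)\<^sup>2) * indicator {0..} x \<partial>lborel) =
      ennreal (1 / (2 * pi))" .
  \<comment> \<open>The step error is odd except at 0, where its value is -1/2; its square is even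
    everywhere.\<close>
  have "(sinc_step_error (- x))\<^sup>2 = (sinc_step_error x)\<^sup>2" for x
  proof (cases "x = 0")
    case False
    then have "sinc_step_error (- x) = - sinc_step_error x"
      by (auto simp: sinc_step_error_def Si_minus field_simps)
    then show ?thesis by simp
  qed simp
  then show ?thesis
    by (subst nn_integral_even) (auto simp: half ennreal_mult'[symmetric] simp flip: ennreal_numeral)
qed

section \<open>Translates of functions of bounded variation\<close>

lemma nn_integral_shift:
  fixes f :: "real \<Rightarrow> ennreal"
  assumes [measurable]: "f \<in> borel_measurable borel"
  shows "(\<integral>\<^sup>+x. f (x + t) \<partial>lborel) = (\<integral>\<^sup>+x. f x \<partial>lborel)"
  using nn_integral_real_affine[OF assms, of 1 t] by (simp add: add.commute)

text \<open>The window is tiled by m half-open blocks of length d, and each is translated back onto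
  the first. The sum thereby moves inside the integral, where for fixed x it runs over the grid x, x
  + d, x + 2d, and so on.\<close>

lemma nn_integral_fold_blocks:
  fixes f :: "real \<Rightarrow> ennreal"
  assumes [measurable]: "f \<in> borel_measurable borel" and "0 < d"
  shows "(\<integral>\<^sup>+x. f x * indicator {a..<a + real m * d} x \<partial>lborel)
    = (\<integral>\<^sup>+x. (\<Sum>k<m. f (x + real k * d)) * indicator {a..<a + d} x \<partial>lborel)"
proof (induction m)
  case (Suc m)
  have split: "f x * indicator {a..<v} x = f x * indicator {a..<u} x + f x * indicator {u..<v} x"
    if "a \<le> u" "u \<le> v" for u v x
    using that by (auto simp: indicator_def)
  have "(\<integral>\<^sup>+x. f x * indicator {a..<a + real (Suc m) * d} x \<partial>lborel) =
      (\<integral>\<^sup>+x. f x * indicator {a..<a + real m * d} x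
        + f x * indicator {a + real m * d..<a + real (Suc m) * d} x \<partial>lborel)"
    using \<open>0 < d\<close> by (intro nn_integral_cong split) auto
  also have "\<dots> = (\<integral>\<^sup>+x. (\<Sum>k<m. f (x + real k * d)) * indicator {a..<a + d} x \<partial>lborel)
      + (\<integral>\<^sup>+x. f x * indicator {a + real m * d..<a + real (Suc m) * d} x \<partial>lborel)"
    by (simp add: nn_integral_add Suc.IH)
  also have "(\<integral>\<^sup>+x. f x * indicator {a + real m * d..<a + real (Suc m) * d} x \<partial>lborel)
      = (\<integral>\<^sup>+x. f (x + real m * d) * indicator {a..<a + d} x \<partial>lborel)"
    by (subst nn_integral_shift[symmetric, where t = "real m * d"])
       (auto intro!: nn_integral_cong simp: indicator_def algebra_simps)
  finally show ?case
    by (simp add: nn_integral_add[symmetric] distrib_right)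
qed simp

lemma total_variation_ge:
  assumes "mono t"
  shows "(\<Sum>i<m. ennreal \<bar>g (t (Suc i)) - g (t i)\<bar>) \<le> total_variation g"
  unfolding total_variation_def
  using assms by (intro SUP_upper2[of m] SUP_upper2[of t]) (auto intro: mono_imp_mono_on)

text \<open>After folding, the integrand at x is a sum of increments of \<open>p\<close> along a
  single grid, hence at most the total variation. Only x in one block of length d remains to be
  integrated, which gives the factor d. Fatou's lemma passes from windows to the whole line.\<close>

lemma nn_integral_translation_diff_le:
  assumes [measurable]: "p \<in> borel_measurable borel" and "0 < d"
  shows "(\<integral>\<^sup>+x. ennreal \<bar>p (x + d) - p x\<bar> \<partial>lborel) \<le> ennreal d * total_variation p"
proof -
  let ?f = "\<lambda>x. ennreal \<bar>p (x + d) - p x\<bar>"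
  have window: "(\<integral>\<^sup>+x. ?f x * indicator {a..<a + real m * d} x \<partial>lborel) \<le> ennreal d * total_variation p"
    for a m
  proof -
    have "(\<integral>\<^sup>+x. ?f x * indicator {a..<a + real m * d} x \<partial>lborel)
        = (\<integral>\<^sup>+x. (\<Sum>k<m. ?f (x + real k * d)) * indicator {a..<a + d} x \<partial>lborel)"
      using \<open>0 < d\<close> by (intro nn_integral_fold_blocks) auto
    also have "\<dots> \<le> (\<integral>\<^sup>+x. total_variation p * indicator {a..<a + d} x \<partial>lborel)"
    proof (intro nn_integral_mono mult_right_mono)
      fix x
      have "mono (\<lambda>k. x + real k * d)"
        using \<open>0 < d\<close> by (auto intro!: monoI mult_right_mono)
      from total_variation_ge[OF this, of p m]
      show "(\<Sum>k<m. ?f (x + real k * d)) \<le> total_variation p"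
        by (simp add: algebra_simps)
    qed auto
    also have "\<dots> = ennreal d * total_variation p"
      using \<open>0 < d\<close> by (simp add: nn_integral_cmult mult.commute)
    finally show ?thesis .
  qed
  \<comment> \<open>This is the symmetric window [-nd, nd), written as 2n blocks so that the window
    bound applies.\<close>
  define S where "S n = {- (real n * d)..<- (real n * d) + real (2 * n) * d}" for n
  have "(\<lambda>n. ?f x * indicator (S n) x) \<longlonglongrightarrow> ?f x" for x
  proof (rule tendsto_eventually)
    obtain N where N: "\<bar>x\<bar> < real N * d"
      using reals_Archimedean3[OF \<open>0 < d\<close>] by blast
    show "\<forall>\<^sub>F n in sequentially. ?f x * indicator (S n) x = ?f x"
      using eventually_ge_at_top[of N]
    proof eventually_elim
      case (elim n)
      then have "real N * d \<le> real n * d"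
        using \<open>0 < d\<close> by (intro mult_right_mono) auto
      with N have "- (real n * d) \<le> x" "x < real n * d"
        by linarith+
      then have "x \<in> S n"
        by (simp add: S_def mult.commute)
      then show ?case by simp
    qed
  qed
  then have "(\<integral>\<^sup>+x. ?f x \<partial>lborel) = (\<integral>\<^sup>+x. liminf (\<lambda>n. ?f x * indicator (S n) x) \<partial>lborel)"
    by (intro nn_integral_cong lim_imp_Liminf[symmetric]) auto
  also have "\<dots> \<le> liminf (\<lambda>n. \<integral>\<^sup>+x. ?f x * indicator (S n) x \<partial>lborel)"
    by (intro nn_integral_liminf) (auto simp: S_def)
  also have "\<dots> \<le> ennreal d * total_variation p"
    unfolding S_def by (intro Liminf_le always_eventually allI window) auto
  finally show ?thesis .
qed

text \<open>Young's inequality, an instance of Cauchy--Schwarz with the weight \<^term>\<open>\<bar>r y\<bar>\<close>.\<close>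

lemma nn_integral_convolution_square_le:
  fixes g r :: "real \<Rightarrow> real"
  assumes [measurable]: "g \<in> borel_measurable borel" "r \<in> borel_measurable borel"
  shows "(\<integral>\<^sup>+x. ennreal ((\<integral>y. g (x - y) * r y \<partial>lborel)\<^sup>2) \<partial>lborel)
    \<le> (\<integral>\<^sup>+y. ennreal \<bar>r y\<bar> \<partial>lborel)\<^sup>2 * (\<integral>\<^sup>+x. ennreal ((g x)\<^sup>2) \<partial>lborel)"
proof -
  let ?R = "\<integral>\<^sup>+y. ennreal \<bar>r y\<bar> \<partial>lborel"
  have pointwise: "ennreal ((\<integral>y. g (x - y) * r y \<partial>lborel)\<^sup>2)
      \<le> (\<integral>\<^sup>+y. ennreal ((g (x - y))\<^sup>2 * \<bar>r y\<bar>) \<partial>lborel) * ?R" for x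
  proof (cases "integrable lborel (\<lambda>y. g (x - y) * r y)")
    case True
    have "ennreal ((\<integral>y. g (x - y) * r y \<partial>lborel)\<^sup>2) = (ennreal \<bar>\<integral>y. g (x - y) * r y \<partial>lborel\<bar>)\<^sup>2"
      by (simp add: ennreal_power)
    also have "\<dots> \<le> (\<integral>\<^sup>+y. ennreal \<bar>g (x - y) * r y\<bar> \<partial>lborel)\<^sup>2"
      using integral_norm_bound_ennreal[OF True] by (intro power_mono) auto
    \<comment> \<open>Splitting \<open>\<bar>r y\<bar>\<close> into two square roots leaves the
      weight in both Cauchy-Schwarz factors.\<close>
    also have "(\<integral>\<^sup>+y. ennreal \<bar>g (x - y) * r y\<bar> \<partial>lborel)
        = (\<integral>\<^sup>+y. ennreal (\<bar>g (x - y)\<bar> * sqrt \<bar>r y\<bar>) * ennreal (sqrt \<bar>r y\<bar>) \<partial>lborel)"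
      by (intro nn_integral_cong) (simp add: abs_mult mult.assoc flip: ennreal_mult)
    also have "\<dots>\<^sup>2 \<le> (\<integral>\<^sup>+y. (ennreal (\<bar>g (x - y)\<bar> * sqrt \<bar>r y\<bar>))\<^sup>2 \<partial>lborel)
        * (\<integral>\<^sup>+y. (ennreal (sqrt \<bar>r y\<bar>))\<^sup>2 \<partial>lborel)"
      by (intro Cauchy_Schwarz_nn_integral) auto
    finally show ?thesis
      by (simp add: ennreal_power power_mult_distrib)
  \<comment> \<open>A Bochner integral without integrability is 0 by convention, so the bound is
    trivial in this case.\<close>
  qed (simp add: not_integrable_integral_eq)
  have "(\<integral>\<^sup>+x. ennreal ((\<integral>y. g (x - y) * r y \<partial>lborel)\<^sup>2) \<partial>lborel)
      \<le> (\<integral>\<^sup>+x. (\<integral>\<^sup>+y. ennreal ((g (x - y))\<^sup>2 * \<bar>r y\<bar>) \<partial>lborel) * ?R \<partial>lborel)"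
    by (intro nn_integral_mono pointwise)
  also have "\<dots> = (\<integral>\<^sup>+x. (\<integral>\<^sup>+y. ennreal ((g (x - y))\<^sup>2 * \<bar>r y\<bar>) \<partial>lborel) \<partial>lborel) * ?R"
    by (intro nn_integral_multc) auto
  also have "(\<integral>\<^sup>+x. (\<integral>\<^sup>+y. ennreal ((g (x - y))\<^sup>2 * \<bar>r y\<bar>) \<partial>lborel) \<partial>lborel)
      = (\<integral>\<^sup>+y. (\<integral>\<^sup>+x. ennreal ((g (x - y))\<^sup>2 * \<bar>r y\<bar>) \<partial>lborel) \<partial>lborel)"
    by (intro lborel_pair.Fubini') auto
  also have "\<dots> = (\<integral>\<^sup>+y. (\<integral>\<^sup>+x. ennreal ((g x)\<^sup>2) \<partial>lborel) * ennreal \<bar>r y\<bar> \<partial>lborel)"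
  proof (intro nn_integral_cong)
    fix y
    show "(\<integral>\<^sup>+x. ennreal ((g (x - y))\<^sup>2 * \<bar>r y\<bar>) \<partial>lborel) = (\<integral>\<^sup>+x. ennreal ((g x)\<^sup>2) \<partial>lborel) * ennreal \<bar>r y\<bar>"
      using nn_integral_shift[of "\<lambda>x. ennreal ((g x)\<^sup>2)" "- y"]
      by (simp add: ennreal_mult'' nn_integral_multc)
  qed
  also have "\<dots> = (\<integral>\<^sup>+x. ennreal ((g x)\<^sup>2) \<partial>lborel) * ?R"
    by (intro nn_integral_cmult) auto
  finally show ?thesis
    by (simp add: power2_eq_square mult_ac)
qed

section \<open>Bias\<close>

text \<open>By the mean value theorem the quotient is a value of the kernel divided by h. Uniformity
  in e and w supplies the majorant for dominated convergence.\<close>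

lemma Si_difference_quotient_bound:
  assumes "0 < e" "0 < h"
  shows "\<bar>(Si ((w + e) / h) - Si (w / h)) / (pi * e)\<bar> \<le> 1 / (pi * h)"
proof -
  have "w / h < (w + e) / h"
    using assms by (simp add: divide_strict_right_mono)
  from MVT2[OF this, of Si "\<lambda>x. pi * sinc_kernel x"] DERIV_Si_sinc_kernel
  obtain z where "Si ((w + e) / h) - Si (w / h) = ((w + e) / h - w / h) * (pi * sinc_kernel z)"
    by blast
  then have "(Si ((w + e) / h) - Si (w / h)) / (pi * e) = sinc_kernel z / h"
    using assms by (simp add: diff_divide_distrib[symmetric])
  moreover have "\<bar>sinc_kernel z\<bar> / h \<le> 1 / pi / h"
    using abs_sinc_kernel_le[of z] assms by (intro divide_right_mono) auto
  ultimately show ?thesis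
    using assms by simp
qed

lemma Si_difference_quotient_tendsto:
  assumes "0 < h" and e: "e \<longlonglongrightarrow> 0" "\<And>n. e n \<noteq> 0"
  shows "(\<lambda>n. (Si ((w + e n) / h) - Si (w / h)) / (pi * e n)) \<longlonglongrightarrow> sinc_kernel (w / h) / h"
proof -
  have "((\<lambda>x. Si (x / h) / pi) has_real_derivative sinc_kernel (w / h) / h) (at w)"
    by (rule DERIV_cong[OF DERIV_cdivide[OF DERIV_chain2[OF DERIV_Si_sinc_kernel DERIV_cdivide[OF DERIV_ident]]]])
       simp
  then have "(\<lambda>n. (Si ((w + e n) / h) / pi - Si (w / h) / pi) / e n) \<longlonglongrightarrow> sinc_kernel (w / h) / h"
    unfolding DERIV_def
    by (rule filterlim_compose) (use e in \<open>auto simp: filterlim_at\<close>)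
  then show ?thesis
    by (simp add: diff_divide_distrib)
qed

text \<open>The difference is the average of p(x + s) - p(x) over s in (0, e]. Exchanging the
  integrals reduces its L1 norm to the translation estimate s V. Bounded variation thus gives L1
  convergence of the averages to \<open>p\<close> without any continuity assumption.\<close>

lemma nn_integral_moving_average_diff_le:
  fixes p :: "real \<Rightarrow> real"
  assumes int: "integrable lborel p" and V: "0 \<le> V" "total_variation p = ennreal V" and "0 < e"
  shows "(\<integral>\<^sup>+x. ennreal \<bar>(\<integral>y. indicator {-e..<0} (x - y) * p y \<partial>lborel) / e - p x\<bar> \<partial>lborel)
    \<le> ennreal (e * V)"
proof -
  have [measurable]: "p \<in> borel_measurable borel"
    using int by (simp add: borel_measurable_integrable)
  have pointwise: "ennreal \<bar>(\<integral>y. indicator {-e..<0} (x - y) * p y \<partial>lborel) / e - p x\<bar>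
     \<le> (\<integral>\<^sup>+s. ennreal (\<bar>p (x + s) - p x\<bar> * (indicator {0<..e} s / e)) \<partial>lborel)" for x
  proof -
    have int': "integrable lborel (\<lambda>s. indicator {0<..e} s *\<^sub>R p (x + s))"
      by (intro integrable_mult_indicator) (use lborel_integrable_real_affine[OF int, of 1 x] in auto)
    have intc: "integrable lborel (\<lambda>s. indicator {0<..e} s *\<^sub>R p x)"
      using \<open>0 < e\<close> by (intro integrable_scaleR_left) auto
    have "(\<integral>y. indicator {-e..<0} (x - y) * p y \<partial>lborel)
        = (\<integral>s. indicator {0<..e} s *\<^sub>R p (x + s) \<partial>lborel)"
      by (subst lborel_integral_real_affine[where c = 1 and t = x])
         (auto intro!: Bochner_Integration.integral_cong simp: indicator_def)
    moreover have "e * p x = (\<integral>s. indicator {0<..e} s *\<^sub>R p x \<partial>lborel)"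
      using \<open>0 < e\<close> by simp
    moreover have "(\<integral>s. indicator {0<..e} s *\<^sub>R p (x + s) \<partial>lborel) / e - p x =
        ((\<integral>s. indicator {0<..e} s *\<^sub>R p (x + s) \<partial>lborel) - e * p x) / e"
      using \<open>0 < e\<close> by (simp add: field_simps)
    ultimately have "(\<integral>y. indicator {-e..<0} (x - y) * p y \<partial>lborel) / e - p x =
        (\<integral>s. (indicator {0<..e} s *\<^sub>R p (x + s) - indicator {0<..e} s *\<^sub>R p x) / e \<partial>lborel)"
      using int' intc by simp
    moreover have "\<bar>indicator {0<..e} s *\<^sub>R p (x + s) - indicator {0<..e} s *\<^sub>R p x\<bar>
        = \<bar>p (x + s) - p x\<bar> * indicator {0<..e} s" for s
      by (simp add: indicator_def)
    ultimately show ?thesis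
      using integral_norm_bound_ennreal[of lborel
          "\<lambda>s. (indicator {0<..e} s *\<^sub>R p (x + s) - indicator {0<..e} s *\<^sub>R p x) / e"] int' intc \<open>0 < e\<close>
      by simp
  qed
  have "(\<integral>\<^sup>+x. ennreal \<bar>(\<integral>y. indicator {-e..<0} (x - y) * p y \<partial>lborel) / e - p x\<bar> \<partial>lborel)
      \<le> (\<integral>\<^sup>+x. (\<integral>\<^sup>+s. ennreal (\<bar>p (x + s) - p x\<bar> * (indicator {0<..e} s / e)) \<partial>lborel) \<partial>lborel)"
    by (intro nn_integral_mono pointwise)
  also have "\<dots> = (\<integral>\<^sup>+s. (\<integral>\<^sup>+x. ennreal (\<bar>p (x + s) - p x\<bar> * (indicator {0<..e} s / e)) \<partial>lborel) \<partial>lborel)"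
    by (intro lborel_pair.Fubini') auto
  also have "\<dots> \<le> (\<integral>\<^sup>+s. ennreal V * indicator {0<..e} s \<partial>lborel)"
  proof (intro nn_integral_mono)
    fix s
    show "(\<integral>\<^sup>+x. ennreal (\<bar>p (x + s) - p x\<bar> * (indicator {0<..e} s / e)) \<partial>lborel)
        \<le> ennreal V * indicator {0<..e} s"
    proof (cases "s \<in> {0<..e}")
      case True
      then have "(\<integral>\<^sup>+x. ennreal (\<bar>p (x + s) - p x\<bar> * (indicator {0<..e} s / e)) \<partial>lborel)
          = (\<integral>\<^sup>+x. ennreal \<bar>p (x + s) - p x\<bar> \<partial>lborel) * ennreal (1 / e)"
        using \<open>0 < e\<close> by (subst nn_integral_multc[symmetric]) (auto simp flip: ennreal_mult'')
      also have "\<dots> \<le> (ennreal s * ennreal V) * ennreal (1 / e)"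
        using nn_integral_translation_diff_le[of p s] True V by (intro mult_right_mono) auto
      also have "\<dots> = ennreal (s / e * V)"
        using True V by (simp add: ennreal_mult[symmetric] mult_ac)
      \<comment> \<open>The crude bound s / e <= 1 costs a factor 2, harmless because only the limit
        e -> 0 matters.\<close>
      also have "\<dots> \<le> ennreal V"
        using True V by (intro ennreal_leI mult_left_le_one_le) auto
      finally show ?thesis
        using True by simp
    qed simp
  qed
  also have "\<dots> = ennreal (e * V)"
    using \<open>0 < e\<close> V by (simp add: nn_integral_cmult ennreal_mult mult.commute)
  finally show ?thesis .
qed

text \<open>
  Convolving the difference quotients of \<^term>\<open>p\<close> with \<^const>\<open>sinc_step_error\<close> approximates the
  bias almost everywhere, and Young's inequality bounds these convolutions by the variation.
\<close>

lemma sinc_bias_le: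
  fixes p :: "real \<Rightarrow> real"
  assumes int: "integrable lborel p" and V: "0 \<le> V" "total_variation p = ennreal V" and "0 < h"
  shows "(\<integral>\<^sup>+x. ennreal (((\<integral>y. sinc_kernel ((x - y) / h) / h * p y \<partial>lborel) - p x)\<^sup>2) \<partial>lborel)
    \<le> ennreal (V\<^sup>2 * h / pi)"
proof -
  have [measurable]: "p \<in> borel_measurable borel"
    using int by (simp add: borel_measurable_integrable)
  define e where "e n = 1 / real (Suc n)" for n
  have e_pos: "0 < e n" for n by (simp add: e_def)
  have e_lim: "e \<longlonglongrightarrow> 0"
    unfolding e_def by (rule LIMSEQ_Suc[OF lim_1_over_n])
  \<comment> \<open>\<open>r n\<close> stands in for the Stieltjes measure dp, and
    \<open>D n\<close> is its convolution with the scaled step error. \<open>A n\<close> and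
    \<open>q n\<close> are the two pieces of \<open>D n\<close>: a smooth one tending to the
    convolution of the scaled kernel with \<open>p\<close>, and a moving average of \<open>p\<close>
    produced by the jump.\<close>
  define r where "r n y = (p (y + e n) - p y) / e n" for n y
  define D where "D n x = (\<integral>y. sinc_step_error ((x - y) / h) * r n y \<partial>lborel)" for n x
  define A where "A n w = (Si ((w + e n) / h) - Si (w / h)) / (pi * e n)" for n w
  define q where "q n x = (\<integral>y. indicator {-e n..<0} (x - y) * p y \<partial>lborel) / e n" for n x
  have [measurable]: "r n \<in> borel_measurable borel" "D n \<in> borel_measurable borel"
    "A n \<in> borel_measurable borel" "q n \<in> borel_measurable borel" for n
    unfolding r_def D_def A_def q_def by measurable
  obtain B where B: "\<And>x. \<bar>sinc_step_error x\<bar> \<le> B"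
    using sinc_step_error_bounded by blast
  have int_mult: "integrable lborel (\<lambda>y. f y * p y)"
    if [measurable]: "f \<in> borel_measurable borel" and "\<And>y. \<bar>f y\<bar> \<le> C" for f :: "real \<Rightarrow> real" and C
  proof (rule Bochner_Integration.integrable_bound[of _ "\<lambda>y. C * p y"])
    have "\<bar>f y\<bar> \<le> \<bar>C\<bar>" for y
      using that(2)[of y] by linarith
    then show "AE y in lborel. norm (f y * p y) \<le> norm (C * p y)"
      by (simp add: abs_mult mult_right_mono)
  qed (use int in auto)
  have A_le: "\<bar>A n w\<bar> \<le> 1 / (pi * h)" for n w
    unfolding A_def by (rule Si_difference_quotient_bound[OF e_pos \<open>0 < h\<close>])

  \<comment> \<open>This is summation by parts: a translation of y moves the difference quotient
    from \<open>p\<close> to the step error, whose increment splits into its sine-integral part and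
    its jump.\<close>
  have D_eq: "D n x = (\<integral>y. A n (x - y) * p y \<partial>lborel) - q n x" for n x
  proof -
    let ?G = "\<lambda>w. sinc_step_error (w / h)"
    have int_G: "integrable lborel (\<lambda>y. ?G (w - y) * p y)" for w
      by (intro int_mult[of _ B] B) auto
    have shift: "integrable lborel (\<lambda>y. ?G (x - y) * p (y + e n))"
      "(\<integral>y. ?G (x - y) * p (y + e n) \<partial>lborel) = (\<integral>y. ?G (x + e n - y) * p y \<partial>lborel)"
      using lborel_integrable_real_affine[OF int_G[of "x + e n"], of 1 "e n"]
        lborel_integral_real_affine[of 1 "\<lambda>y. ?G (x + e n - y) * p y" "e n"]
      by (simp_all add: add.commute)
    have "D n x = (\<integral>y. (?G (x - y) * p (y + e n) - ?G (x - y) * p y) / e n \<partial>lborel)"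
      unfolding D_def r_def by (intro Bochner_Integration.integral_cong) (auto simp: algebra_simps)
    also have "\<dots> = ((\<integral>y. ?G (x + e n - y) * p y \<partial>lborel) - (\<integral>y. ?G (x - y) * p y \<partial>lborel)) / e n"
      using shift int_G by simp
    also have "\<dots> = (\<integral>y. (?G (x + e n - y) * p y - ?G (x - y) * p y) / e n \<partial>lborel)"
      using int_G by simp
    also have "\<dots> = (\<integral>y. A n (x - y) * p y - indicator {-e n..<0} (x - y) * p y / e n \<partial>lborel)"
    proof (intro Bochner_Integration.integral_cong refl)
      fix y
      have "?G (x + e n - y) - ?G (x - y) =
          (Si ((x - y + e n) / h) - Si ((x - y) / h)) / pi - indicator {-e n..<0} (x - y)"
      proof -
        have "indicator {-(e n / h)..<0} ((x - y) / h) = (indicator {-e n..<0} (x - y) :: real)"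
          using \<open>0 < h\<close> by (auto simp: indicator_def field_simps)
        then show ?thesis
          using sinc_step_error_diff[of "e n / h" "(x - y) / h"] e_pos[of n] \<open>0 < h\<close>
          by (simp add: add_divide_distrib diff_divide_distrib algebra_simps)
      qed
      then have "(?G (x + e n - y) - ?G (x - y)) / e n * p y =
          (A n (x - y) - indicator {-e n..<0} (x - y) / e n) * p y"
        using e_pos[of n] by (simp add: A_def diff_divide_distrib)
      then show "(?G (x + e n - y) * p y - ?G (x - y) * p y) / e n =
          A n (x - y) * p y - indicator {-e n..<0} (x - y) * p y / e n"
        by (simp add: algebra_simps diff_divide_distrib)
    qed
    also have "\<dots> = (\<integral>y. A n (x - y) * p y \<partial>lborel) - q n x"
      unfolding q_def using int_mult[of "\<lambda>y. A n (x - y)" "1 / (pi * h)"] A_le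
        int_mult[of "\<lambda>y. indicator {-e n..<0} (x - y)" 1]
      by (subst Bochner_Integration.integral_diff) (auto simp: indicator_def)
    finally show ?thesis .
  qed

  have smooth_lim: "(\<lambda>n. \<integral>y. A n (x - y) * p y \<partial>lborel)
      \<longlonglongrightarrow> (\<integral>y. sinc_kernel ((x - y) / h) / h * p y \<partial>lborel)" for x
  proof (rule integral_dominated_convergence[where w = "\<lambda>y. 1 / (pi * h) * \<bar>p y\<bar>"])
    show "AE y in lborel. (\<lambda>n. A n (x - y) * p y) \<longlonglongrightarrow> sinc_kernel ((x - y) / h) / h * p y"
      unfolding A_def using e_pos
      by (intro AE_I2 tendsto_intros Si_difference_quotient_tendsto e_lim \<open>0 < h\<close>)
         (auto simp: less_imp_neq[symmetric])
    show "AE y in lborel. norm (A n (x - y) * p y) \<le> 1 / (pi * h) * \<bar>p y\<bar>" for n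
      unfolding real_norm_def abs_mult by (intro AE_I2 mult_right_mono A_le) auto
  qed (use int in auto)

  have q_le: "(\<integral>\<^sup>+x. ennreal \<bar>q n x - p x\<bar> \<partial>lborel) \<le> ennreal (e n * V)" for n
    unfolding q_def by (rule nn_integral_moving_average_diff_le[OF int V e_pos])
  have q_int: "integrable lborel (\<lambda>x. q n x - p x)" for n
    using q_le[of n] by (intro integrableI_bounded) (auto intro: le_less_trans)
  have "(\<lambda>n. \<integral>x. norm (q n x - p x) \<partial>lborel) \<longlonglongrightarrow> 0"
  proof (rule tendsto_sandwich[OF _ _ tendsto_const])
    show "\<forall>\<^sub>F n in sequentially. (\<integral>x. norm (q n x - p x) \<partial>lborel) \<le> e n * V"
    proof (intro always_eventually allI)
      fix n
      have "ennreal (\<integral>x. norm (q n x - p x) \<partial>lborel) \<le> ennreal (e n * V)"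
        using q_le[of n] by (subst nn_integral_eq_integral[symmetric]) (auto intro: q_int)
      then show "(\<integral>x. norm (q n x - p x) \<partial>lborel) \<le> e n * V"
        using V e_pos[of n] by (subst (asm) ennreal_le_iff) auto
    qed
    show "(\<lambda>n. e n * V) \<longlonglongrightarrow> 0"
      using tendsto_mult_right[OF e_lim, of V] by simp
  qed (auto intro!: always_eventually)
  \<comment> \<open>L1 convergence gives convergence almost everywhere along a subsequence. This
    suffices for Fatou's lemma, since the bound on \<open>D n\<close> will be uniform in n.\<close>
  from tendsto_L1_AE_subseq[OF q_int this] obtain s where s: "strict_mono s"
    and q_lim: "AE x in lborel. (\<lambda>n. q (s n) x - p x) \<longlonglongrightarrow> 0"
    by blast

  \<comment> \<open>In Young's inequality \<open>r n\<close> has L1 norm at most V by the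
    translation estimate, and rescaling by h turns the square integral 1 / pi of the step error into
    h / pi.\<close>
  have D_le: "(\<integral>\<^sup>+x. ennreal ((D n x)\<^sup>2) \<partial>lborel) \<le> ennreal (V\<^sup>2 * h / pi)" for n
  proof -
    have "(\<integral>\<^sup>+y. ennreal \<bar>r n y\<bar> \<partial>lborel)
        = (\<integral>\<^sup>+y. ennreal \<bar>p (y + e n) - p y\<bar> * ennreal (1 / e n) \<partial>lborel)"
      using e_pos[of n] by (intro nn_integral_cong) (simp add: r_def abs_divide flip: ennreal_mult)
    also have "\<dots> = (\<integral>\<^sup>+y. ennreal \<bar>p (y + e n) - p y\<bar> \<partial>lborel) * ennreal (1 / e n)"
      by (intro nn_integral_multc) auto
    also have "\<dots> \<le> (ennreal (e n) * ennreal V) * ennreal (1 / e n)"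
      using nn_integral_translation_diff_le[of p "e n"] e_pos[of n] V by (intro mult_right_mono) auto
    also have "\<dots> = ennreal V"
      using e_pos[of n] V by (simp flip: ennreal_mult)
    finally have r_le: "(\<integral>\<^sup>+y. ennreal \<bar>r n y\<bar> \<partial>lborel) \<le> ennreal V" .
    have "(\<integral>\<^sup>+x. ennreal ((D n x)\<^sup>2) \<partial>lborel)
        \<le> (\<integral>\<^sup>+y. ennreal \<bar>r n y\<bar> \<partial>lborel)\<^sup>2 * (\<integral>\<^sup>+x. ennreal ((sinc_step_error (x / h))\<^sup>2) \<partial>lborel)"
      unfolding D_def by (rule nn_integral_convolution_square_le[of "\<lambda>x. sinc_step_error (x / h)"]) auto
    also have "(\<integral>\<^sup>+x. ennreal ((sinc_step_error (x / h))\<^sup>2) \<partial>lborel) = ennreal h * ennreal (1 / pi)"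
      using \<open>0 < h\<close>
      by (subst nn_integral_real_affine[where c = h and t = 0])
         (auto simp: nn_integral_sinc_step_error_square)
    also have "(\<integral>\<^sup>+y. ennreal \<bar>r n y\<bar> \<partial>lborel)\<^sup>2 * (ennreal h * ennreal (1 / pi))
        \<le> (ennreal V)\<^sup>2 * (ennreal h * ennreal (1 / pi))"
      by (intro mult_right_mono power_mono r_le) auto
    also have "\<dots> = ennreal (V\<^sup>2 * h / pi)"
      using V \<open>0 < h\<close> by (simp add: ennreal_power flip: ennreal_mult)
    finally show ?thesis .
  qed

  have "AE x in lborel. ennreal (((\<integral>y. sinc_kernel ((x - y) / h) / h * p y \<partial>lborel) - p x)\<^sup>2)
      = liminf (\<lambda>n. ennreal ((D (s n) x)\<^sup>2))"
    using q_lim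
  proof eventually_elim
    case (elim x)
    \<comment> \<open>Writing q as (q - p) + p exposes the part known to vanish in the
      limit.\<close>
    have "(\<lambda>n. (\<integral>y. A (s n) (x - y) * p y \<partial>lborel) - (q (s n) x - p x + p x))
        \<longlonglongrightarrow> (\<integral>y. sinc_kernel ((x - y) / h) / h * p y \<partial>lborel) - (0 + p x)"
      by (intro tendsto_intros elim LIMSEQ_subseq_LIMSEQ[OF smooth_lim s, unfolded comp_def])
    then have "(\<lambda>n. ennreal ((D (s n) x)\<^sup>2))
        \<longlonglongrightarrow> ennreal (((\<integral>y. sinc_kernel ((x - y) / h) / h * p y \<partial>lborel) - p x)\<^sup>2)"
      by (intro tendsto_intros) (simp add: D_eq)
    then show ?case
      by (intro lim_imp_Liminf[symmetric]) auto
  qed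
  then have "(\<integral>\<^sup>+x. ennreal (((\<integral>y. sinc_kernel ((x - y) / h) / h * p y \<partial>lborel) - p x)\<^sup>2) \<partial>lborel)
      = (\<integral>\<^sup>+x. liminf (\<lambda>n. ennreal ((D (s n) x)\<^sup>2)) \<partial>lborel)"
    by (rule nn_integral_cong_AE)
  also have "\<dots> \<le> liminf (\<lambda>n. \<integral>\<^sup>+x. ennreal ((D (s n) x)\<^sup>2) \<partial>lborel)"
    by (intro nn_integral_liminf) auto
  also have "\<dots> \<le> ennreal (V\<^sup>2 * h / pi)"
    by (intro Liminf_le always_eventually allI D_le) auto
  finally show ?thesis .
qed

section \<open>Variance\<close>

text \<open>This is the bias-variance decomposition. The centred variables \<open>Z j\<close> are
  orthogonal by independence, so only the n diagonal terms of the double sum survive. The uniform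
  bound on \<open>Y\<close> supplies the integrability.\<close>

lemma (in prob_space) mean_square_error_sample_mean:
  fixes Y :: "nat \<Rightarrow> 'a \<Rightarrow> real"
  assumes "1 \<le> n" and indep: "indep_vars (\<lambda>_. borel) Y {1..n}"
    and bound: "\<And>j \<omega>. \<bar>Y j \<omega>\<bar> \<le> C"
    and mean: "\<And>j. j \<in> {1..n} \<Longrightarrow> expectation (Y j) = m"
    and second_moment: "\<And>j. j \<in> {1..n} \<Longrightarrow> expectation (\<lambda>\<omega>. (Y j \<omega>)\<^sup>2) = v"
  shows "integrable M (\<lambda>\<omega>. ((\<Sum>j=1..n. Y j \<omega>) / real n - c)\<^sup>2)"
    and "expectation (\<lambda>\<omega>. ((\<Sum>j=1..n. Y j \<omega>) / real n - c)\<^sup>2) = (v - m\<^sup>2) / real n + (m - c)\<^sup>2"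
proof -
  have meas [measurable]: "random_variable borel (Y j)" if "j \<in> {1..n}" for j
    using indep that by (simp add: indep_vars_def)
  have int: "integrable M (Y j)" if "j \<in> {1..n}" for j
    using bound meas[OF that] by (intro integrable_const_bound[of _ C]) auto
  define Z where "Z j \<omega> = Y j \<omega> - m" for j \<omega>
  have int_Z: "integrable M (Z j)" if "j \<in> {1..n}" for j
    unfolding Z_def using int[OF that] by auto
  have mean_Z: "expectation (Z j) = 0" if "j \<in> {1..n}" for j
    unfolding Z_def using int[OF that] mean[OF that] by (simp add: prob_space)
  have Y_sq: "integrable M (\<lambda>\<omega>. (Y j \<omega>)\<^sup>2)" if "j \<in> {1..n}" for j
  proof (rule integrable_const_bound[of _ "C\<^sup>2"])
    show "AE \<omega> in M. norm ((Y j \<omega>)\<^sup>2) \<le> C\<^sup>2"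
      using power_mono[OF bound abs_ge_zero, of j _ 2] by simp
  qed (use meas[OF that] in measurable)
  have Z_prod: "integrable M (\<lambda>\<omega>. Z i \<omega> * Z j \<omega>) \<and>
      expectation (\<lambda>\<omega>. Z i \<omega> * Z j \<omega>) = (if i = j then v - m\<^sup>2 else 0)"
    if ij: "i \<in> {1..n}" "j \<in> {1..n}" for i j
  proof (cases "i = j")
    case True
    have "(\<lambda>\<omega>. Z i \<omega> * Z i \<omega>) = (\<lambda>\<omega>. (Y i \<omega>)\<^sup>2 - 2 * m * Y i \<omega> + m\<^sup>2)"
      by (auto simp: Z_def power2_eq_square algebra_simps)
    then show ?thesis
      using True int[OF ij(1)] Y_sq[OF ij(1)] mean[OF ij(1)] second_moment[OF ij(1)]
      by (simp add: prob_space power2_eq_square)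
  next
    case False
    have "indep_vars (\<lambda>_. borel) Z {1..n}"
      using indep_vars_compose2[OF indep, of "\<lambda>_ y. y - m" "\<lambda>_. borel"] by (simp add: Z_def[abs_def])
    then have "indep_vars (\<lambda>_. borel) Z {i, j}"
      by (rule indep_vars_subset) (use ij in auto)
    moreover have "integrable M (Z k)" if "k \<in> {i, j}" for k
      using that ij int_Z by auto
    ultimately show ?thesis
      using indep_vars_integrable[of "{i, j}" Z] indep_vars_lebesgue_integral[of "{i, j}" Z]
        False mean_Z[OF ij(1)] by simp
  qed
  have dev: "(\<Sum>j=1..n. Y j \<omega>) / real n - c = (\<Sum>j=1..n. Z j \<omega>) / real n + (m - c)" for \<omega>
    using \<open>1 \<le> n\<close> by (simp add: Z_def sum_subtractf field_simps)
  \<comment> \<open>The three terms yield the variance, a cross term of mean zero, and the squared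
    bias.\<close>
  have expand: "((\<Sum>j=1..n. Y j \<omega>) / real n - c)\<^sup>2 =
      (\<Sum>i=1..n. \<Sum>j=1..n. Z i \<omega> * Z j \<omega>) / (real n)\<^sup>2
      + 2 * (m - c) / real n * (\<Sum>j=1..n. Z j \<omega>) + (m - c)\<^sup>2" for \<omega>
  proof -
    have "(s / k + d)\<^sup>2 = s * s / k\<^sup>2 + 2 * d / k * s + d\<^sup>2" for s k d :: real
      by (simp add: power2_sum power_divide) (simp add: power2_eq_square)
    then show ?thesis
      unfolding dev sum_product[symmetric] .
  qed
  have sums: "integrable M (\<lambda>\<omega>. \<Sum>i=1..n. \<Sum>j=1..n. Z i \<omega> * Z j \<omega>)"
      "integrable M (\<lambda>\<omega>. \<Sum>j=1..n. Z j \<omega>)"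
    using Z_prod int_Z by (auto intro!: Bochner_Integration.integrable_sum)
  show "integrable M (\<lambda>\<omega>. ((\<Sum>j=1..n. Y j \<omega>) / real n - c)\<^sup>2)"
    unfolding expand using sums by auto
  have "expectation (\<lambda>\<omega>. \<Sum>i=1..n. \<Sum>j=1..n. Z i \<omega> * Z j \<omega>)
      = (\<Sum>i=1..n. \<Sum>j=1..n. expectation (\<lambda>\<omega>. Z i \<omega> * Z j \<omega>))"
    using Z_prod
    by (subst Bochner_Integration.integral_sum)
       (auto intro!: sum.cong Bochner_Integration.integral_sum Bochner_Integration.integrable_sum)
  also have "\<dots> = (\<Sum>i=1..n. \<Sum>j=1..n. if i = j then v - m\<^sup>2 else 0)"
    using Z_prod by (intro sum.cong refl) blast
  also have "\<dots> = real n * (v - m\<^sup>2)"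
    by simp
  finally have "expectation (\<lambda>\<omega>. \<Sum>i=1..n. \<Sum>j=1..n. Z i \<omega> * Z j \<omega>) = real n * (v - m\<^sup>2)" .
  moreover have "expectation (\<lambda>\<omega>. \<Sum>j=1..n. Z j \<omega>) = 0"
    using int_Z mean_Z by (simp add: Bochner_Integration.integral_sum)
  ultimately show "expectation (\<lambda>\<omega>. ((\<Sum>j=1..n. Y j \<omega>) / real n - c)\<^sup>2) = (v - m\<^sup>2) / real n + (m - c)\<^sup>2"
    unfolding expand using sums \<open>1 \<le> n\<close> by (simp add: prob_space power2_eq_square)
qed

text \<open>For fixed x the estimator is the sample mean of the scaled kernel at x - X j. Tonelli
  lets the mean square error be computed pointwise in x. The remaining integral on the right is the
  integrated squared bias.\<close>

lemma (in prob_space) MISE_sinc_estimator_le: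
  assumes n: "1 \<le> n" and indep: "indep_vars (\<lambda>_. borel) X {1..n}"
    and p_nonneg: "\<And>x. 0 \<le> p x"
    and dist: "\<And>j. j \<in> {1..n} \<Longrightarrow> distributed M lborel (X j) (\<lambda>x. ennreal (p x))"
    and "0 < h"
  shows "MISE M (sinc_estimator X n h) p \<le> ennreal (1 / (pi * real n * h)) +
    (\<integral>\<^sup>+x. ennreal (((\<integral>y. sinc_kernel ((x - y) / h) / h * p y \<partial>lborel) - p x)\<^sup>2) \<partial>lborel)"
proof -
  have "1 \<in> {1..n}" using n by simp
  note dist1 = dist[OF this]
  have [measurable]: "p \<in> borel_measurable borel"
    using distributed_real_measurable[OF _ dist1] p_nonneg by simp
  have X_meas [measurable]: "random_variable borel (X j)" if "j \<in> {1..n}" for j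
    using distributed_measurable[OF dist[OF that]] by simp
  define K where "K u = sinc_kernel (u / h) / h" for u
  have [measurable]: "K \<in> borel_measurable borel"
    unfolding K_def by measurable
  define m where "m x = (\<integral>y. K (x - y) * p y \<partial>lborel)" for x
  define v where "v x = (\<integral>y. (K (x - y))\<^sup>2 * p y \<partial>lborel)" for x
  have [measurable]: "m \<in> borel_measurable borel" "v \<in> borel_measurable borel"
    unfolding m_def v_def by measurable
  have K_bound: "\<bar>K u\<bar> \<le> 1 / pi / h" for u
    using abs_sinc_kernel_le[of "u / h"] \<open>0 < h\<close> unfolding K_def
    by (simp only: abs_divide abs_of_pos) (intro divide_right_mono, auto)
  have estimator: "sinc_estimator X n h \<omega> x = (\<Sum>j=1..n. K (x - X j \<omega>)) / real n" for \<omega> x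
    unfolding sinc_estimator_def K_def by (simp add: sum_divide_distrib[symmetric] mult.commute)

  have mse: "(\<integral>\<^sup>+\<omega>. ennreal ((sinc_estimator X n h \<omega> x - p x)\<^sup>2) \<partial>M)
      \<le> (\<integral>\<^sup>+y. ennreal ((K (x - y))\<^sup>2) * ennreal (p y) \<partial>lborel) * ennreal (1 / real n)
        + ennreal ((m x - p x)\<^sup>2)" for x
  proof -
    have v_nonneg: "0 \<le> v x"
      unfolding v_def using p_nonneg by (intro integral_nonneg_AE) auto
    have "integrable M (\<lambda>\<omega>. (K (x - X 1 \<omega>))\<^sup>2)"
    proof (rule integrable_const_bound[of _ "(1 / pi / h)\<^sup>2"])
      show "AE \<omega> in M. norm ((K (x - X 1 \<omega>))\<^sup>2) \<le> (1 / pi / h)\<^sup>2"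
        using power_mono[OF K_bound abs_ge_zero, of _ 2] by simp
    qed (use \<open>1 \<in> {1..n}\<close> in measurable)
    then have K_sq: "integrable lborel (\<lambda>y. p y * (K (x - y))\<^sup>2)"
      using distributed_integrable[OF dist1, of "\<lambda>y. (K (x - y))\<^sup>2"] p_nonneg by simp
    have *: "expectation (\<lambda>\<omega>. g (X j \<omega>)) = (\<integral>y. g y * p y \<partial>lborel)"
      if "j \<in> {1..n}" and [measurable]: "g \<in> borel_measurable borel" for g :: "real \<Rightarrow> real" and j
      using distributed_integral[OF dist[OF that(1)], of g] p_nonneg by (simp add: mult.commute)
    have indep_Y: "indep_vars (\<lambda>_. borel) (\<lambda>j \<omega>. K (x - X j \<omega>)) {1..n}"
      by (rule indep_vars_compose2[OF indep]) measurable
    note mean_square_error_sample_mean[OF n indep_Y K_bound, of "m x" "v x" "p x"]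
    moreover have "expectation (\<lambda>\<omega>. K (x - X j \<omega>)) = m x"
      "expectation (\<lambda>\<omega>. (K (x - X j \<omega>))\<^sup>2) = v x" if "j \<in> {1..n}" for j
      unfolding m_def v_def using that by (auto intro!: *)
    ultimately have "(\<integral>\<^sup>+\<omega>. ennreal ((sinc_estimator X n h \<omega> x - p x)\<^sup>2) \<partial>M)
        = ennreal ((v x - (m x)\<^sup>2) / real n + (m x - p x)\<^sup>2)"
      unfolding estimator by (subst nn_integral_eq_integral) auto
    \<comment> \<open>The variance is bounded by the second moment, which is linear in
      \<open>p\<close> and can be integrated over x exactly.\<close>
    also have "\<dots> \<le> ennreal (v x * (1 / real n) + (m x - p x)\<^sup>2)"
      by (intro ennreal_leI add_right_mono) (simp add: divide_right_mono)
    also have "\<dots> = ennreal (v x) * ennreal (1 / real n) + ennreal ((m x - p x)\<^sup>2)"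
      using v_nonneg by (subst ennreal_plus) (auto simp flip: ennreal_mult)
    also have "ennreal (v x) = (\<integral>\<^sup>+y. ennreal ((K (x - y))\<^sup>2) * ennreal (p y) \<partial>lborel)"
      unfolding v_def using K_sq p_nonneg
      by (subst nn_integral_eq_integral[symmetric]) (auto simp: mult.commute ennreal_mult)
    finally show ?thesis .
  qed

  have "MISE M (sinc_estimator X n h) p =
      (\<integral>\<^sup>+x. (\<integral>\<^sup>+\<omega>. ennreal ((sinc_estimator X n h \<omega> x - p x)\<^sup>2) \<partial>M) \<partial>lborel)"
  proof -
    interpret pair_sigma_finite M lborel ..
    show ?thesis
      unfolding MISE_def estimator by (intro Fubini'[symmetric]) measurable
  qed
  also have "\<dots> \<le> (\<integral>\<^sup>+x. (\<integral>\<^sup>+y. ennreal ((K (x - y))\<^sup>2) * ennreal (p y) \<partial>lborel) * ennreal (1 / real n)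
        + ennreal ((m x - p x)\<^sup>2) \<partial>lborel)"
    by (intro nn_integral_mono mse)
  also have "\<dots> = (\<integral>\<^sup>+x. (\<integral>\<^sup>+y. ennreal ((K (x - y))\<^sup>2) * ennreal (p y) \<partial>lborel) \<partial>lborel) * ennreal (1 / real n)
        + (\<integral>\<^sup>+x. ennreal ((m x - p x)\<^sup>2) \<partial>lborel)"
    by (simp add: nn_integral_add nn_integral_multc)
  also have "(\<integral>\<^sup>+x. (\<integral>\<^sup>+y. ennreal ((K (x - y))\<^sup>2) * ennreal (p y) \<partial>lborel) \<partial>lborel)
      = (\<integral>\<^sup>+y. (\<integral>\<^sup>+x. ennreal ((K (x - y))\<^sup>2) * ennreal (p y) \<partial>lborel) \<partial>lborel)"
    by (intro lborel_pair.Fubini') auto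
  also have "\<dots> = (\<integral>\<^sup>+y. ennreal (1 / (pi * h)) * ennreal (p y) \<partial>lborel)"
  proof (intro nn_integral_cong)
    fix y
    have "(\<integral>\<^sup>+x. ennreal ((K (x - y))\<^sup>2) \<partial>lborel) = (\<integral>\<^sup>+x. ennreal ((K x)\<^sup>2) \<partial>lborel)"
      using nn_integral_shift[of "\<lambda>x. ennreal ((K x)\<^sup>2)" "- y"] by simp
    \<comment> \<open>The substitution contributes h and the squared normalisation 1 / h^2, so the
      square integral scales by 1 / h.\<close>
    also have "\<dots> = ennreal h * (\<integral>\<^sup>+x. ennreal ((sinc_kernel x)\<^sup>2) * ennreal (1 / h\<^sup>2) \<partial>lborel)"
      using \<open>0 < h\<close>
      by (subst nn_integral_real_affine[where c = h and t = 0])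
         (auto simp: K_def power_divide simp flip: ennreal_mult)
    also have "(\<integral>\<^sup>+x. ennreal ((sinc_kernel x)\<^sup>2) * ennreal (1 / h\<^sup>2) \<partial>lborel)
        = ennreal (1 / pi) * ennreal (1 / h\<^sup>2)"
      by (simp add: nn_integral_multc nn_integral_sinc_kernel_square)
    also have "ennreal h * (ennreal (1 / pi) * ennreal (1 / h\<^sup>2)) = ennreal (1 / (pi * h))"
      using \<open>0 < h\<close> by (simp add: power2_eq_square flip: ennreal_mult)
    finally show "(\<integral>\<^sup>+x. ennreal ((K (x - y))\<^sup>2) * ennreal (p y) \<partial>lborel) = ennreal (1 / (pi * h)) * ennreal (p y)"
      by (simp add: nn_integral_multc)
  qed
  \<comment> \<open>The density has total mass 1, read off from the distribution of
    \<open>X 1\<close> with the constant test function 1.\<close>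
  also have "\<dots> = ennreal (1 / (pi * h))"
    using distributed_nn_integral[OF dist1, of "\<lambda>_. 1"]
    by (simp add: nn_integral_cmult emeasure_space_1)
  finally show ?thesis
    using \<open>0 < h\<close> by (simp add: m_def K_def mult_ac flip: ennreal_mult)
qed

section \<open>Combining variance and bias\<close>

theorem theorem6:
  fixes M :: "'a measure" and X :: "nat \<Rightarrow> 'a \<Rightarrow> real" and p :: "real \<Rightarrow> real"
    and n :: nat and V h0 :: real
  assumes "prob_space M"
    and "n \<ge> 1"
    and "prob_space.indep_vars M (\<lambda>_. borel) X {1..n}"
    and "\<And>x. 0 \<le> p x"
    and "\<And>j. j \<in> {1..n} \<Longrightarrow> distributed M lborel (X j) (\<lambda>x. ennreal (p x))"
    and "0 \<le> V" and "total_variation p = ennreal V"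
    and "h0 > 0"
  shows "MISE M (sinc_estimator X n (h0 / sqrt (real n))) p
           \<le> ennreal (1 / (pi * sqrt (real n)) * (V\<^sup>2 * h0 + 1 / h0))"
proof -
  interpret prob_space M by fact
  let ?h = "h0 / sqrt (real n)"
  have n: "0 < real n" using assms(2) by simp
  have h: "0 < ?h" using n \<open>h0 > 0\<close> by simp
  have dist1: "distributed M lborel (X 1) (\<lambda>x. ennreal (p x))"
    using assms(2,5) by simp
  have "integrable lborel p"
    using distributed_integrable[OF dist1, of "\<lambda>_. 1"] assms(4) by simp
  note bias = sinc_bias_le[OF this assms(6,7) h]
  have "MISE M (sinc_estimator X n ?h) p
      \<le> ennreal (1 / (pi * real n * ?h)) + ennreal (V\<^sup>2 * ?h / pi)"
    using MISE_sinc_estimator_le[OF assms(2-5) h] bias by (rule order_trans[OF _ add_left_mono])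
  also have "\<dots> = ennreal (1 / (pi * real n * ?h) + V\<^sup>2 * ?h / pi)"
    using n \<open>h0 > 0\<close> by (intro ennreal_plus[symmetric]) auto
  \<comment> \<open>The bandwidth makes n h equal to h0 sqrt n, so variance and squared bias are
    both of order 1 / sqrt n.\<close>
  also have "1 / (pi * real n * ?h) + V\<^sup>2 * ?h / pi = 1 / (pi * sqrt (real n)) * (V\<^sup>2 * h0 + 1 / h0)"
    using n \<open>h0 > 0\<close> real_sqrt_mult_self[of "real n"] by (simp add: field_simps)
  finally show ?thesis .
qed

end
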